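(* Let $\mathfrak{X}\subseteq\mathcal{P}(\mathbb{N})$ be an arithmetically closed family of reals such that the poset $\mathfrak{X}/\mathrm{Fin}$ is countably closed. Then $\mathfrak{X}=\mathcal{P}(\mathbb{N})$.
   Context: A family $\mathfrak{X}\subseteq\mathcal{P}(\mathbb{N})$ is arithmetically closed if whenever $A\in\mathfrak{X}$ and $B$ is arithmetically definable from $A$, then $B\in\mathfrak{X}$. The poset $\mathfrak{X}/\mathrm{Fin}$ consists of the infinite sets in $\mathfrak{X}$ ordered by almost inclusion ($A\leq B$ iff $A\setminus B$ is finite). Countably closed means every descending $\omega$-sequence of conditions has a lower bound. *)

theory Defs
  imports Main
begin

text \<open>
  First-order arithmetic in the language with \<open>0, 1, +, \<times>, =, <\<close> and one additional unary
  predicate symbol, interpreted by a set \<open>A\<close> of natural numbers. Variables are named by natural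
  numbers; formulas are evaluated in the standard model expanded by \<open>A\<close>.
\<close>

datatype arith_term =
    Var nat
  | Zero
  | One
  | Plus arith_term arith_term
  | Times arith_term arith_term

datatype arith_form =
    Eq arith_term arith_term
  | Less arith_term arith_term
  | InSet arith_term
  | Neg arith_form
  | Conj arith_form arith_form
  | Exists nat arith_form

primrec term_val :: "(nat \<Rightarrow> nat) \<Rightarrow> arith_term \<Rightarrow> nat" where
  "term_val e (Var x) = e x"
| "term_val e Zero = 0"
| "term_val e One = 1"
| "term_val e (Plus s t) = term_val e s + term_val e t"
| "term_val e (Times s t) = term_val e s * term_val e t"

primrec sat :: "nat set \<Rightarrow> (nat \<Rightarrow> nat) \<Rightarrow> arith_form \<Rightarrow> bool" where
  "sat A e (Eq s t) \<longleftrightarrow> term_val e s = term_val e t"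
| "sat A e (Less s t) \<longleftrightarrow> term_val e s < term_val e t"
| "sat A e (InSet t) \<longleftrightarrow> term_val e t \<in> A"
| "sat A e (Neg \<phi>) \<longleftrightarrow> \<not> sat A e \<phi>"
| "sat A e (Conj \<phi> \<psi>) \<longleftrightarrow> sat A e \<phi> \<and> sat A e \<psi>"
| "sat A e (Exists x \<phi>) \<longleftrightarrow> (\<exists>n. sat A (e(x := n)) \<phi>)"

primrec term_vars :: "arith_term \<Rightarrow> nat set" where
  "term_vars (Var x) = {x}"
| "term_vars Zero = {}"
| "term_vars One = {}"
| "term_vars (Plus s t) = term_vars s \<union> term_vars t"
| "term_vars (Times s t) = term_vars s \<union> term_vars t"

primrec free_vars :: "arith_form \<Rightarrow> nat set" where
  "free_vars (Eq s t) = term_vars s \<union> term_vars t"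
| "free_vars (Less s t) = term_vars s \<union> term_vars t"
| "free_vars (InSet t) = term_vars t"
| "free_vars (Neg \<phi>) = free_vars \<phi>"
| "free_vars (Conj \<phi> \<psi>) = free_vars \<phi> \<union> free_vars \<psi>"
| "free_vars (Exists x \<phi>) = free_vars \<phi> - {x}"

text \<open>
  The variable \<open>0\<close> is the only one that may occur free in the defining formula, so the truth value
  depends on the assignment \<open>e\<close> only through \<open>e 0\<close>.
\<close>

definition arith_definable_from :: "nat set \<Rightarrow> nat set \<Rightarrow> bool" where
  "arith_definable_from B A \<longleftrightarrow>
     (\<exists>\<phi>. free_vars \<phi> \<subseteq> {0} \<and> (\<forall>e. sat A e \<phi> \<longleftrightarrow> e 0 \<in> B))"

definition arith_closed :: "nat set set \<Rightarrow> bool" where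
  "arith_closed X \<longleftrightarrow> (\<forall>A B. A \<in> X \<longrightarrow> arith_definable_from B A \<longrightarrow> B \<in> X)"

definition almost_subset :: "nat set \<Rightarrow> nat set \<Rightarrow> bool" where
  "almost_subset A B \<longleftrightarrow> finite (A - B)"

text \<open>
  The conditions of \<open>X/Fin\<close> are the infinite members of \<open>X\<close> themselves, not their classes modulo
  finite difference; \<open>almost_subset\<close> is a preorder on them.
\<close>

definition mod_fin :: "nat set set \<Rightarrow> nat set set" where
  "mod_fin X = {A \<in> X. infinite A}"

definition countably_closed :: "'a set \<Rightarrow> ('a \<Rightarrow> 'a \<Rightarrow> bool) \<Rightarrow> bool" where
  "countably_closed P le \<longleftrightarrow>
     (\<forall>p :: nat \<Rightarrow> 'a. (\<forall>n. p n \<in> P) \<longrightarrow> (\<forall>n. le (p (Suc n)) (p n)) \<longrightarrow>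
        (\<exists>q\<in>P. \<forall>n. le q (p n)))"

end

theory Submission
  imports Defs "HOL-Library.Infinite_Set"
begin

text \<open>
  Read a number \<open>x = (a + b)\<^sup>2 + a\<close> as a code for the set of all \<open>i\<close> such that
  \<open>1 + (i + 1) * b\<close> divides \<open>a\<close>; by coprimality of the moduli (as for Goedel's beta function),
  every finite 0-1 pattern is realised by infinitely many codes. Given \<open>B\<close>, the codes that agree
  with \<open>B\<close> below \<open>n\<close> form a descending sequence of infinite sets, each definable without
  parameters. If \<open>q\<close> is an infinite set almost contained in all of them, then \<open>n \<in> B\<close> iff all but
  finitely many elements of \<open>q\<close> code a set containing \<open>n\<close>; so \<open>B\<close> is arithmetical in \<open>q\<close>.
\<close>

definition in_code :: "nat \<Rightarrow> nat \<Rightarrow> bool" where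
  "in_code i x \<longleftrightarrow> (\<exists>a b c. x = (a + b) * (a + b) + a \<and> a = (1 + (i + 1) * b) * c)"

definition agree_below :: "nat set \<Rightarrow> nat \<Rightarrow> nat set" where
  "agree_below B n = {x. \<forall>i<n. in_code i x \<longleftrightarrow> i \<in> B}"

text \<open>Since \<open>a\<close> is at most \<open>a + b\<close>, the code lies between the square
  of \<open>a + b\<close> and the next square, so \<open>a + b\<close> is its integer square
  root.\<close>

lemma square_pairing_sum_le:
  fixes a b a' b' :: nat
  assumes "(a + b) * (a + b) + a = (a' + b') * (a' + b') + a'"
  shows "a + b \<le> a' + b'"
proof (rule ccontr)
  assume "\<not> a + b \<le> a' + b'"
  then have "Suc (a' + b') \<le> a + b" by simp
  then have "Suc (a' + b') * Suc (a' + b') \<le> (a + b) * (a + b)" by (intro mult_le_mono)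
  with assms show False by simp
qed

lemma square_pairing_inject:
  fixes a b a' b' :: nat
  assumes "(a + b) * (a + b) + a = (a' + b') * (a' + b') + a'"
  shows "a = a' \<and> b = b'"
proof -
  have "a + b = a' + b'"
    using square_pairing_sum_le[OF assms] square_pairing_sum_le[OF assms[symmetric]] by simp
  with assms show ?thesis by simp
qed

lemma in_code_pair_iff: "in_code i ((a + b) * (a + b) + a) \<longleftrightarrow> 1 + (i + 1) * b dvd a"
proof
  assume "in_code i ((a + b) * (a + b) + a)"
  then obtain a' b' c where eq: "(a + b) * (a + b) + a = (a' + b') * (a' + b') + a'"
    and a': "a' = (1 + (i + 1) * b') * c"
    unfolding in_code_def by blast
  from square_pairing_inject[OF eq] have "a = (1 + (i + 1) * b) * c" using a' by simp
  then show "1 + (i + 1) * b dvd a" by (rule dvdI)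
next
  assume "1 + (i + 1) * b dvd a"
  then show "in_code i ((a + b) * (a + b) + a)" unfolding in_code_def by (blast elim: dvdE)
qed

text \<open>A common divisor \<open>d\<close> is coprime to \<open>b\<close>, because the moduli are
  1 modulo \<open>b\<close>. It divides the difference \<open>(j - i) * b\<close>, hence
  \<open>j - i\<close>, hence \<open>b\<close>, so it is a unit.\<close>

lemma coprime_beta_moduli_less:
  fixes b i j :: nat
  assumes "i < j" "j - i dvd b"
  shows "coprime (1 + (i + 1) * b) (1 + (j + 1) * b)"
proof (rule coprimeI)
  fix d assume d: "d dvd 1 + (i + 1) * b" "d dvd 1 + (j + 1) * b"
  have "coprime d b"
  proof (rule coprimeI)
    fix k assume "k dvd d" "k dvd b"
    then have "k dvd 1 + (i + 1) * b" "k dvd (i + 1) * b" using d dvd_trans by auto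
    then show "is_unit k" using dvd_add_left_iff by blast
  qed
  have "d dvd (1 + (j + 1) * b) - (1 + (i + 1) * b)" using d by (rule_tac dvd_diff_nat)
  also have "(1 + (j + 1) * b) - (1 + (i + 1) * b) = (j - i) * b"
    by (simp add: diff_mult_distrib)
  finally have "d dvd j - i" using \<open>coprime d b\<close> coprime_dvd_mult_left_iff by blast
  then have "d dvd b" using assms(2) dvd_trans by blast
  with \<open>coprime d b\<close> show "is_unit d" by auto
qed

lemma coprime_beta_moduli:
  fixes b i j n :: nat
  assumes "i < n" "j < n" "i \<noteq> j" "fact n dvd b"
  shows "coprime (1 + (i + 1) * b) (1 + (j + 1) * b)"
proof -
  have *: "coprime (1 + (k + 1) * b) (1 + (l + 1) * b)" if "k < l" "l < n" for k l
  proof (rule coprime_beta_moduli_less[OF \<open>k < l\<close>])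
    have "l - k dvd fact n" using that by (intro dvd_fact) auto
    then show "l - k dvd b" using assms(4) dvd_trans by blast
  qed
  show ?thesis
    using *[of i j] *[of j i] assms by (cases "i < j") (auto simp: coprime_commute)
qed

lemma infinite_agree_below: "infinite (agree_below B n)"
proof -
  have "\<exists>x\<in>agree_below B n. k < x" for k
  proof -
    \<comment> \<open>The factorial makes the moduli with index below \<open>n\<close> pairwise
      coprime; the factor \<open>Suc k\<close> pushes the code beyond \<open>k\<close>.\<close>
    define b :: nat where "b = fact n * Suc k"
    \<comment> \<open>Among the moduli with index below \<open>n\<close>, exactly those with index
      in \<open>B\<close> divide this product.\<close>
    define a where "a = (\<Prod>j | j < n \<and> j \<in> B. 1 + (j + 1) * b)"
    define x where "x = (a + b) * (a + b) + a"
    have b: "fact n dvd b" "0 < b" by (simp_all add: b_def)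
    have "in_code i x \<longleftrightarrow> i \<in> B" if "i < n" for i
    proof
      assume "i \<in> B"
      then show "in_code i x"
        unfolding x_def in_code_pair_iff a_def using that by (intro dvd_prodI) auto
    next
      assume "in_code i x"
      then have dvd: "1 + (i + 1) * b dvd a" unfolding x_def in_code_pair_iff .
      show "i \<in> B"
      proof (rule ccontr)
        assume "i \<notin> B"
        then have "coprime (1 + (i + 1) * b) a"
          unfolding a_def using that b by (intro prod_coprime_right coprime_beta_moduli[of _ n]) auto
        from coprime_common_divisor[OF this dvd_refl dvd] have "is_unit (1 + (i + 1) * b)" .
        with b show False by simp
      qed
    qed
    then have "x \<in> agree_below B n" by (simp add: agree_below_def)
    moreover have "k < b" using mult_le_mono1[OF fact_ge_1, of "Suc k" n] unfolding b_def
      by (simp only: mult_1 Suc_le_eq)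
    moreover have "b \<le> x"
      using le_square[of "a + b"] unfolding x_def by (meson add_leD2 trans_le_add1)
    ultimately show ?thesis by (intro bexI[of _ x]) (rule less_le_trans)
  qed
  then show ?thesis by (meson infinite_nat_iff_unbounded)
qed

primrec numeral_term :: "nat \<Rightarrow> arith_term" where
  "numeral_term 0 = Zero"
| "numeral_term (Suc n) = Plus (numeral_term n) One"

lemma term_val_numeral_term [simp]: "term_val e (numeral_term n) = n"
  by (induction n) simp_all

lemma term_vars_numeral_term [simp]: "term_vars (numeral_term n) = {}"
  by (induction n) simp_all

lemma term_val_fun_upd [simp]: "x \<notin> term_vars t \<Longrightarrow> term_val (e(x := n)) t = term_val e t"
  by (induction t) auto

text \<open>The bound variables start at 3, leaving 0, 1 and 2 free for use in \<open>s\<close> and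
  \<open>t\<close> without capture.\<close>

definition in_code_form :: "arith_term \<Rightarrow> arith_term \<Rightarrow> arith_form" where
  "in_code_form s t = Exists 3 (Exists 4 (Exists 5 (Conj
     (Eq t (Plus (Times (Plus (Var 3) (Var 4)) (Plus (Var 3) (Var 4))) (Var 3)))
     (Eq (Var 3) (Times (Plus One (Times (Plus s One) (Var 4))) (Var 5))))))"

lemma sat_in_code_form:
  assumes "(term_vars s \<union> term_vars t) \<inter> {3, 4, 5} = {}"
  shows "sat A e (in_code_form s t) \<longleftrightarrow> in_code (term_val e s) (term_val e t)"
  using assms by (simp add: in_code_form_def in_code_def)

lemma free_vars_in_code_form: "free_vars (in_code_form s t) \<subseteq> term_vars s \<union> term_vars t"
  by (auto simp: in_code_form_def)

text \<open>The finitely many bits of \<open>B\<close> below \<open>n\<close> are hard-wired into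
  the formula, which therefore never uses \<open>InSet\<close>, even if \<open>B\<close> is not
  arithmetical.\<close>

primrec agree_below_form :: "nat set \<Rightarrow> nat \<Rightarrow> arith_form" where
  "agree_below_form B 0 = Eq Zero Zero"
| "agree_below_form B (Suc n) =
     Conj (if n \<in> B then in_code_form (numeral_term n) (Var 0)
           else Neg (in_code_form (numeral_term n) (Var 0)))
          (agree_below_form B n)"

lemma arith_definable_agree_below: "arith_definable_from (agree_below B n) A"
proof -
  have "sat A e (agree_below_form B n) \<longleftrightarrow> e 0 \<in> agree_below B n" for e
    by (induction n) (auto simp: agree_below_def sat_in_code_form less_Suc_eq)
  moreover have "free_vars (agree_below_form B n) \<subseteq> {0}"
    using free_vars_in_code_form[of "numeral_term _" "Var 0"] by (induction n) auto
  ultimately show ?thesis unfolding arith_definable_from_def by blast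
qed

lemma arith_definable_eventually_in_code:
  "arith_definable_from {n. \<exists>m. \<forall>x\<in>q. m < x \<longrightarrow> in_code n x} q"
proof -
  \<comment> \<open>Variable 0 is the tested number, 1 the bound \<open>m\<close> and 2 the element
    of \<open>q\<close>; the universal quantifier over \<open>q\<close> becomes a negated
    existential.\<close>
  define \<phi> where "\<phi> = Exists 1 (Neg (Exists 2 (Conj (InSet (Var 2))
    (Conj (Less (Var 1) (Var 2)) (Neg (in_code_form (Var 0) (Var 2)))))))"
  have "free_vars \<phi> \<subseteq> {0}"
    using free_vars_in_code_form[of "Var 0" "Var 2"] by (auto simp: \<phi>_def)
  moreover have "sat q e \<phi> \<longleftrightarrow> e 0 \<in> {n. \<exists>m. \<forall>x\<in>q. m < x \<longrightarrow> in_code n x}" for e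
    by (auto simp: \<phi>_def sat_in_code_form)
  ultimately show ?thesis unfolding arith_definable_from_def by blast
qed

lemma eventually_in_code_eq:
  assumes "infinite q" and "\<And>n. almost_subset q (agree_below B n)"
  shows "{n. \<exists>m. \<forall>x\<in>q. m < x \<longrightarrow> in_code n x} = B"
proof -
  have "(\<exists>m. \<forall>x\<in>q. m < x \<longrightarrow> in_code n x) \<longleftrightarrow> n \<in> B" for n
  proof -
    \<comment> \<open>The successor is essential: \<open>agree_below B n\<close> says nothing about
      index \<open>n\<close> itself.\<close>
    have "finite (q - agree_below B (Suc n))" using assms(2) by (simp add: almost_subset_def)
    then obtain k where k: "\<And>x. x \<in> q - agree_below B (Suc n) \<Longrightarrow> x \<le> k"
      using finite_nat_set_iff_bounded_le by auto
    have agree: "in_code n x \<longleftrightarrow> n \<in> B" if "x \<in> q" "k < x" for x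
      using k[of x] that by (auto simp: agree_below_def)
    show ?thesis
    proof
      assume "\<exists>m. \<forall>x\<in>q. m < x \<longrightarrow> in_code n x"
      then obtain m where m: "\<forall>x\<in>q. m < x \<longrightarrow> in_code n x" ..
      \<comment> \<open>Infinitude of \<open>q\<close> keeps the eventual condition from holding
        vacuously: some element lies beyond both bounds.\<close>
      obtain x where "x \<in> q" "max k m < x"
        using \<open>infinite q\<close> by (meson infinite_nat_iff_unbounded)
      then show "n \<in> B" using m agree by auto
    next
      assume "n \<in> B"
      then show "\<exists>m. \<forall>x\<in>q. m < x \<longrightarrow> in_code n x" using agree by blast
    qed
  qed
  then show ?thesis by blast
qed

theorem theorem3p2:
  fixes X :: "nat set set"
  assumes "X \<noteq> {}"
    and "arith_closed X"
    and "countably_closed (mod_fin X) almost_subset"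
  shows "X = UNIV"
proof -
  have "B \<in> X" for B
  proof -
    \<comment> \<open>Any member of \<open>X\<close> will do, since the sets
      \<open>agree_below B n\<close> are definable from every set.\<close>
    obtain A where "A \<in> X" using assms(1) by blast
    then have "agree_below B n \<in> mod_fin X" for n
      using assms(2) arith_definable_agree_below infinite_agree_below
      unfolding arith_closed_def mod_fin_def by blast
    moreover have "almost_subset (agree_below B (Suc n)) (agree_below B n)" for n
    proof -
      have "agree_below B (Suc n) - agree_below B n = {}" by (auto simp: agree_below_def)
      then show ?thesis unfolding almost_subset_def by (simp only: finite.emptyI)
    qed
    ultimately obtain q where q: "q \<in> mod_fin X" "\<And>n. almost_subset q (agree_below B n)"
      using assms(3)[unfolded countably_closed_def, rule_format, of "agree_below B"] by blast
    then have "arith_definable_from B q"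
      using eventually_in_code_eq[of q B] arith_definable_eventually_in_code[of q]
      by (simp add: mod_fin_def)
    then show ?thesis using q assms(2) unfolding arith_closed_def mod_fin_def by blast
  qed
  then show ?thesis by blast
qed

end
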